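(* Let $n$ be a positive integer and $p$ an odd prime with $p\mid n$. Let $S\subseteq\mathbb{Z}_n$ with $|S|=p$ be such that the Cayley sum graph $\mathrm{CS}(\mathbb{Z}_n,S)$ is connected and of degree $p$. Then $\mathrm{CS}(\mathbb{Z}_n,S)$ admits a total perfect code if and only if $s\not\equiv s'\pmod{p}$ for all distinct $s,s'\in S$.
   Context: For an abelian group $G$ and $S\subseteq G$, the Cayley sum graph $\mathrm{CS}(G,S)$ has vertex set $G$, two vertices $g,h$ adjacent iff $g+h\in S$ and $g\neq h$. A total perfect code of a graph is a set $C$ of vertices such that every vertex has exactly one neighbor in $C$. Elements of $\mathbb{Z}_n$ are identified with integers $0,\dots,n-1$. *)

theory Defs
  imports
    "HOL-Algebra.Elementary_Groups"
    "HOL-Number_Theory.Cong"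
    "Graph_Theory.Digraph_Component"
begin

text \<open>
  As usual in the digraph library, an undirected simple graph is a symmetric loop-free digraph
  without parallel arcs, and the degree of a vertex is its out-degree.
\<close>

definition cayley_sum_graph :: "('a, 'b) monoid_scheme \<Rightarrow> 'a set \<Rightarrow> 'a pair_pre_digraph" where
  "cayley_sum_graph G S =
     \<lparr> pverts = carrier G,
       parcs = {(g, h). g \<in> carrier G \<and> h \<in> carrier G \<and> g \<otimes>\<^bsub>G\<^esub> h \<in> S \<and> g \<noteq> h} \<rparr>"

lemma pair_graph_cayley_sum_graph:
  assumes "comm_group G" "finite (carrier G)"
  shows "pair_graph (cayley_sum_graph G S)"
proof -
  interpret comm_group G by fact
  have "parcs (cayley_sum_graph G S) \<subseteq> carrier G \<times> carrier G"
    by (auto simp: cayley_sum_graph_def)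
  then have "finite (parcs (cayley_sum_graph G S))"
    using assms(2) finite_subset by blast
  then show ?thesis
    using assms(2)
    by unfold_locales
      (auto simp: cayley_sum_graph_def symmetric_def arcs_ends_def arc_to_ends_def m_comm intro!: symI)
qed

definition total_perfect_code :: "('a, 'b) pre_digraph \<Rightarrow> 'a set \<Rightarrow> bool" where
  "total_perfect_code G C \<longleftrightarrow>
     C \<subseteq> verts G \<and> (\<forall>v \<in> verts G. \<exists>!c. c \<in> C \<and> v \<rightarrow>\<^bsub>G\<^esub> c)"

text \<open>
  The cyclic group of order \<open>n\<close> is \<open>integer_mod_group n\<close>, whose carrier is
  \<open>{0..<int n}\<close> for \<open>n > 0\<close>; its operation, written multiplicatively above, is
  addition modulo \<open>n\<close>.
\<close>

end

theory Submission
  imports Defs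
begin

text \<open>
  The degree condition says that no \<open>g + g\<close> lies in \<open>S\<close>, so \<open>C\<close> is a total perfect code iff
  \<open>S \<oplus> (-C)\<close> is a tiling of the cyclic group. If the elements of \<open>S\<close> are distinct modulo \<open>p\<close>,
  the multiples of \<open>p\<close> form a code. Conversely, in a tiling \<open>S \<oplus> D\<close> the factor \<open>S\<close> may be
  multiplied by any integer coprime to \<open>card S = p\<close>. Writing \<open>n = p\<^sup>a m\<close> with \<open>p\<close> not dividing \<open>m\<close>,
  it follows that differences of \<open>D\<close> lying in \<open>m\<int>\<close> never have the same \<open>p\<close>-adic valuation as a
  difference of \<open>S\<close>. If differences of \<open>S\<close> had both the valuation \<open>0\<close> and a valuation \<open>v > 0\<close>,
  then an element of \<open>D\<close> would be determined by its residue modulo \<open>m\<close> and its \<open>p\<close>-adic digits at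
  the remaining \<open>a - 2\<close> positions, so \<open>D\<close> would be too small. Hence if two elements of \<open>S\<close> are
  congruent modulo \<open>p\<close> then all are, and the graph is disconnected because \<open>p > 2\<close>.
\<close>

section \<open>Fixed points of maps of prime order\<close>

text \<open>Every orbit has \<open>1\<close> or \<open>q\<close> elements. The induction removes one
  orbit of size \<open>q\<close> at a time, which changes neither the cardinality modulo
  \<open>q\<close> nor the set of fixed points.\<close>

lemma prime_order_card_fixpoints_cong:
  assumes "finite X" "prime q" "f ` X \<subseteq> X" "\<And>x. x \<in> X \<Longrightarrow> (f ^^ q) x = x"
  shows "[card X = card {x \<in> X. f x = x}] (mod q)"
  using assms(1,3,4)
proof (induction "card X" arbitrary: X rule: less_induct)
  case less
  have q: "1 < q" using assms(2) by (simp add: prime_nat_iff)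
  show ?case
  proof (cases "\<forall>x\<in>X. f x = x")
    case True
    then have "{x \<in> X. f x = x} = X" by auto
    then show ?thesis by simp
  next
    case False
    then obtain x where x: "x \<in> X" "f x \<noteq> x" by auto
    have inX: "(f ^^ i) y \<in> X" if "y \<in> X" for i y
      using that less.prems(2) by (induction i) auto
    have shift: "(f ^^ (i mod q)) y = (f ^^ i) y" if "y \<in> X" for i y
      using funpow_mod_eq[OF less.prems(3)[OF that]] .
    define B where "B = (\<lambda>i. (f ^^ i) x) ` {..<q}"
    have mem: "(f ^^ i) x \<in> B" for i
      unfolding B_def using q shift[OF x(1), of i] by (metis imageI lessThan_iff mod_less_divisor less_trans zero_less_one)
    \<comment> \<open>Since \<open>r\<close> is invertible modulo \<open>q\<close>, the periods
      \<open>r\<close> and \<open>q\<close> together would force the period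
      \<open>1\<close>.\<close>
    have nf: "(f ^^ r) x \<noteq> x" if "0 < r" "r < q" for r
    proof
      assume eq: "(f ^^ r) x = x"
      have "coprime r q"
        using that assms(2) by (metis coprime_commute nat_dvd_not_less prime_imp_coprime)
      then obtain u where "[r * u = 1] (mod q)"
        using cong_solve_coprime_nat by auto
      then have "(r * u) mod q = 1" using q by (simp add: cong_def)
      then have "f x = (f ^^ (r * u)) x" using shift[OF x(1), of "r * u"] by simp
      also have "\<dots> = (f ^^ ((r * u) mod r)) x" using funpow_mod_eq[OF eq] by metis
      finally show False using x(2) by simp
    qed
    have "inj_on (\<lambda>i. (f ^^ i) x) {..<q}"
    proof (rule linorder_inj_onI)
      fix i j assume ij: "i < j" "i \<in> {..<q}" "j \<in> {..<q}"
      show "(f ^^ i) x \<noteq> (f ^^ j) x"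
      proof
        assume "(f ^^ i) x = (f ^^ j) x"
        then have "(f ^^ (q - i)) ((f ^^ i) x) = (f ^^ (q - i)) ((f ^^ j) x)" by simp
        then have "(f ^^ q) x = (f ^^ (q - i + j)) x"
          using ij by (simp flip: funpow_add[THEN fun_cong, simplified comp_def])
        moreover have "q - i + j = q + (j - i)" using ij by simp
        ultimately have "x = (f ^^ (j - i)) x"
          using less.prems(3)[OF x(1)] shift[OF x(1), of "q + (j - i)"] shift[OF x(1), of "j - i"]
          by simp
        moreover have "0 < j - i" "j - i < q" using ij by auto
        ultimately show False using nf by metis
      qed
    qed auto
    then have cardB: "card B = q" unfolding B_def by (simp add: card_image)
    have BX: "B \<subseteq> X" unfolding B_def using inX[OF x(1)] by auto
    have finB: "finite B" unfolding B_def by simp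
    have cX: "card X = q + card (X - B)"
      using cardB BX finB less.prems(1) by (metis card_Diff_subset card_mono le_add_diff_inverse)
    have "f ` (X - B) \<subseteq> X - B"
    proof (rule image_subsetI)
      fix y assume y: "y \<in> X - B"
      have "f y \<notin> B"
      proof
        assume "f y \<in> B"
        then obtain i where i: "f y = (f ^^ i) x" unfolding B_def by auto
        \<comment> \<open>\<open>f ^^ (q - 1)\<close> inverts \<open>f\<close> on \<open>X\<close>,
          so a preimage of an orbit point lies in the orbit.\<close>
        have "y = (f ^^ (q - 1)) (f y)"
          using less.prems(3)[of y] y q by (metis DiffD1 Suc_diff_1 comp_apply funpow_Suc_right less_trans zero_less_one)
        also have "\<dots> = (f ^^ (q - 1 + i)) x" by (simp add: i funpow_add)
        finally show False using mem y by (metis DiffD2)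
      qed
      then show "f y \<in> X - B" using y less.prems(2) by auto
    qed
    then have "[card (X - B) = card {x \<in> X - B. f x = x}] (mod q)"
      using less.hyps[of "X - B"] less.prems cX q by auto
    moreover have "{x \<in> X - B. f x = x} = {x \<in> X. f x = x}"
    proof -
      \<comment> \<open>A fixed orbit point \<open>(f ^^ i) x\<close> would stay put under
        \<open>q - i\<close> further steps, which lead back to \<open>x\<close>.\<close>
      have "f y \<noteq> y" if y: "y \<in> B" for y
      proof
        assume fy: "f y = y"
        obtain i where i: "i < q" "y = (f ^^ i) x" using y unfolding B_def by auto
        have fix_all: "(f ^^ j) y = y" for j by (induction j) (auto simp: fy)
        have "(f ^^ (q - i)) y = (f ^^ q) x"
          using i by (simp flip: funpow_add[THEN fun_cong, simplified comp_def])
        then show False using fix_all less.prems(3)[OF x(1)] x(2) fy by metis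
      qed
      then show ?thesis by auto
    qed
    ultimately show ?thesis unfolding cX by (simp add: cong_def)
  qed
qed

section \<open>Tilings of a cyclic group and their multipliers\<close>

text \<open>The multiplier \<open>k\<close> is a parameter rather than absorbed into
  \<open>S\<close>, so that \<open>S\<close> and its cardinality stay fixed while \<open>k\<close>
  varies. The sets consist of integers, so \<open>D\<close> may contain negative
  representatives.\<close>

definition tiles :: "nat \<Rightarrow> int \<Rightarrow> int set \<Rightarrow> int set \<Rightarrow> bool" where
  "tiles n k S D \<longleftrightarrow> bij_betw (\<lambda>(s, d). (k * s + d) mod int n) (S \<times> D) {0..<int n}"

lemma tiles_card: "tiles n k S D \<Longrightarrow> card S * card D = n"
  unfolding tiles_def by (drule bij_betw_same_card) (simp add: card_cartesian_product)

lemma tiles_inj: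
  assumes "tiles n k S D" "s \<in> S" "s' \<in> S" "d \<in> D" "d' \<in> D"
    and "[k * s + d = k * s' + d'] (mod int n)"
  shows "s = s'" "d = d'"
  using assms unfolding tiles_def bij_betw_def inj_on_def cong_def by fastforce+

lemma tiles_ex:
  assumes "tiles n k S D" "n > 0"
  shows "\<exists>s\<in>S. \<exists>d\<in>D. [k * s + d = g] (mod int n)"
proof -
  have "g mod int n \<in> (\<lambda>(s, d). (k * s + d) mod int n) ` (S \<times> D)"
    using assms unfolding tiles_def bij_betw_def by auto
  then show ?thesis unfolding cong_def by force
qed

lemma tiles_finite:
  assumes "tiles n k S D" "n > 0"
  shows "finite S" "finite D"
  using tiles_card[OF assms(1)] assms(2) card.infinite by fastforce+

text \<open>
  Given \<open>g\<close>, there are \<open>card S ^ (q - 1)\<close> ways to write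
  \<open>g = k (s\<^sub>1 + \<dots> + s\<^sub>q) + d\<close>, as all but one summand from \<open>S\<close> can be chosen freely. Rotation of
  the summands has order \<open>q\<close>, so modulo \<open>q\<close> this counts the representations with all
  \<open>s\<^sub>i\<close> equal, which therefore exist.
\<close>

lemma tiles_mult_prime:
  assumes T: "tiles n k S D" and n: "n > 0" and q: "prime q" "\<not> q dvd card S"
  shows "tiles n (int q * k) S D"
proof -
  note fin = tiles_finite[OF T n]
  have q1: "1 < q" using q(1) by (simp add: prime_nat_iff)
  have surj: "\<exists>s\<in>S. \<exists>d\<in>D. [int q * k * s + d = g] (mod int n)" for g
  proof -
    define L where "L = (\<lambda>r. {xs. set xs \<subseteq> S \<and> length xs = r})"
    define X where "X = {z \<in> L q \<times> D. [k * sum_list (fst z) + snd z = g] (mod int n)}"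
    define f where "f = (\<lambda>z :: int list \<times> int. (rotate1 (fst z), snd z))"
    have finX: "finite X"
      unfolding X_def L_def using fin finite_lists_length_eq[of S q] by auto
    have fpow: "(f ^^ i) z = (rotate i (fst z), snd z)" for i z
      by (induction i) (auto simp: f_def)
    have sumr: "sum_list (rotate1 xs) = sum_list xs" for xs :: "int list"
      by (cases xs) auto
    \<comment> \<open>Dropping the first summand loses nothing: the tiling recovers it, together
      with \<open>d\<close>, from the other \<open>q - 1\<close> summands.\<close>
    have "bij_betw (\<lambda>z. tl (fst z)) X (L (q - 1))"
    proof (rule bij_betwI')
      fix z w assume z: "z \<in> X" "w \<in> X"
      obtain x xs d where zz: "z = (x # xs, d)" "x \<in> S" "d \<in> D"
        using z(1) q1 unfolding X_def L_def by (cases z, cases "fst z") auto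
      obtain y ys e where ww: "w = (y # ys, e)" "y \<in> S" "e \<in> D"
        using z(2) q1 unfolding X_def L_def by (cases w, cases "fst w") auto
      show "(tl (fst z) = tl (fst w)) = (z = w)"
      proof
        assume "tl (fst z) = tl (fst w)"
        then have eq: "xs = ys" using zz ww by simp
        have "[k * sum_list (x # xs) + d = k * sum_list (y # ys) + e] (mod int n)"
          using z zz ww unfolding X_def by (auto intro: cong_trans cong_sym)
        then have "[k * x + d + k * sum_list xs = k * y + e + k * sum_list xs] (mod int n)"
          by (simp add: eq algebra_simps)
        then have "[k * x + d = k * y + e] (mod int n)" by (simp add: cong_add_rcancel)
        then show "z = w" using tiles_inj[OF T zz(2) ww(2) zz(3) ww(3)] zz ww eq by simp
      qed simp
    next
      fix z assume z: "z \<in> X"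
      then show "tl (fst z) \<in> L (q - 1)"
        using q1 unfolding X_def L_def by (cases "fst z") auto
    next
      fix ys assume ys: "ys \<in> L (q - 1)"
      obtain s d where sd: "s \<in> S" "d \<in> D" "[k * s + d = g - k * sum_list ys] (mod int n)"
        using tiles_ex[OF T n] by blast
      have "[k * s + d + k * sum_list ys = g - k * sum_list ys + k * sum_list ys] (mod int n)"
        using sd(3) by (rule cong_add) simp
      then have "(s # ys, d) \<in> X"
        using sd ys q1 unfolding X_def L_def by (auto simp: algebra_simps)
      then show "\<exists>z\<in>X. ys = tl (fst z)" by force
    qed
    then have "card X = card (L (q - 1))" by (rule bij_betw_same_card)
    also have "\<dots> = card S ^ (q - 1)" unfolding L_def using fin(1) by (rule card_lists_length_eq)
    finally have "card X = card S ^ (q - 1)" .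
    then have "\<not> q dvd card X" using q prime_dvd_power by metis
    moreover have "[card X = card {z \<in> X. f z = z}] (mod q)"
    proof (rule prime_order_card_fixpoints_cong[OF finX q(1)])
      show "f ` X \<subseteq> X" by (auto simp: X_def L_def f_def sumr)
      show "(f ^^ q) z = z" if "z \<in> X" for z
        using that by (auto simp: fpow X_def L_def)
    qed
    ultimately have "card {z \<in> X. f z = z} \<noteq> 0"
      by (metis cong_0_iff)
    then have "{z \<in> X. f z = z} \<noteq> {}" by (metis card.empty)
    then obtain xs d where xd: "(xs, d) \<in> X" "rotate1 xs = xs" by (auto simp: f_def)
    have len: "length xs = q" "set xs \<subseteq> S" "d \<in> D" using xd unfolding X_def L_def by auto
    obtain s where s: "set xs = {s}"
      using rotate1_fixpoint_card[OF xd(2)] len(1) q1 by (auto simp: card_1_singleton_iff)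
    then have "xs = replicate q s" using len(1) by (metis replicate_eqI singletonD)
    then have "[int q * k * s + d = g] (mod int n)"
      using xd unfolding X_def by (auto simp: sum_list_replicate algebra_simps)
    then show ?thesis using s len by auto
  qed
  \<comment> \<open>Surjectivity suffices, because \<open>S \<times> D\<close> has exactly
    \<open>n\<close> elements.\<close>
  define h where "h = (\<lambda>(s, d). (int q * k * s + d) mod int n)"
  have im: "h ` (S \<times> D) = {0..<int n}"
  proof
    show "h ` (S \<times> D) \<subseteq> {0..<int n}" using n unfolding h_def by auto
    show "{0..<int n} \<subseteq> h ` (S \<times> D)"
    proof
      fix g assume g: "g \<in> {0..<int n}"
      obtain s d where "s \<in> S" "d \<in> D" "[int q * k * s + d = g] (mod int n)"
        using surj by blast
      then have "h (s, d) = g" "(s, d) \<in> S \<times> D" using g by (auto simp: h_def cong_def)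
      then show "g \<in> h ` (S \<times> D)" by (metis imageI)
    qed
  qed
  moreover have "card (S \<times> D) = n" using tiles_card[OF T] by (simp add: card_cartesian_product)
  ultimately have "inj_on h (S \<times> D)" using fin by (simp add: inj_on_iff_eq_card)
  then show ?thesis using im unfolding tiles_def bij_betw_def h_def by simp
qed

text \<open>The prime factors of \<open>j\<close> are absorbed into the multiplier one at a time;
  none of them divides \<open>card S\<close>.\<close>

lemma tiles_mult_coprime:
  assumes "tiles n k S D" "n > 0" "coprime j (card S)" "j > 0"
  shows "tiles n (int j * k) S D"
  using assms(3,4)
proof (induction j rule: prime_divisors_induct)
  case (factor q j)
  have "\<not> q dvd card S"
    using factor.hyps factor.prems(1) by (metis coprime_mult_left_iff coprime_absorb_left not_prime_unit)
  then have "tiles n (int q * (int j * k)) S D"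
    using tiles_mult_prime[of n "int j * k" S D q] factor assms(2) by auto
  then show ?case by (simp add: mult.assoc)
qed (use assms(1) in auto)

section \<open>Valuations of differences in a tiling\<close>

text \<open>With equal valuations, some \<open>j\<close> coprime to \<open>p\<close> satisfies
  \<open>j * m * (s - s') = d - d'\<close> modulo \<open>n\<close>. Then \<open>(s, d')\<close> and
  \<open>(s', d)\<close> collide in the tiling with multiplier \<open>j * m\<close>.\<close>

lemma tiles_translate_difference_valuation:
  fixes p a m v :: nat and t e :: int
  assumes T: "tiles (p ^ a * m) 1 S D" and p: "prime p" "card S = p" "coprime m p" "m > 0"
    and S: "s \<in> S" "s' \<in> S" "s - s' = int p ^ v * t" "\<not> int p dvd t"
    and D: "d \<in> D" "d' \<in> D" "d - d' = int m * (int p ^ v * e)" "\<not> int p dvd e"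
    and v: "v < a"
  shows False
proof -
  have pos: "p ^ a * m > 0" using p prime_gt_0_nat by simp
  have pp: "prime (int p)" using p by simp
  \<comment> \<open>\<open>r\<close> is the modulus that remains after cancelling
    \<open>m * p ^ v\<close> from \<open>n\<close>.\<close>
  define r where "r = p ^ (a - v)"
  have r1: "r > 1" unfolding r_def using v p(1) prime_gt_1_nat[of p] by (intro one_less_power) auto
  have "coprime t (int r)"
    unfolding r_def using prime_imp_coprime[OF pp S(4)] by (simp add: coprime_commute)
  then obtain u where u: "[t * u = 1] (mod int r)" using cong_solve_coprime_int by blast
  \<comment> \<open>\<open>j\<close> represents the quotient \<open>e / t\<close> modulo
    \<open>r\<close>. It is prime to \<open>p\<close> because \<open>e\<close> is and
    \<open>p\<close> divides \<open>r\<close>.\<close>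
  define j where "j = nat ((u * e) mod int r)"
  have j: "int j = (u * e) mod int r" unfolding j_def using r1 by simp
  have "[t * int j = t * (u * e)] (mod int r)" unfolding j by (simp add: cong_def mod_mult_right_eq)
  also have "t * (u * e) = (t * u) * e" by simp
  also have "[(t * u) * e = 1 * e] (mod int r)" using u by (rule cong_mult) simp
  finally have tj: "int r dvd t * int j - e" by (simp add: cong_iff_dvd_diff)
  have "p dvd r" unfolding r_def using v by simp
  have "\<not> int p dvd int j"
  proof
    assume "int p dvd int j"
    moreover have "int p dvd t * int j - e" using tj \<open>p dvd r\<close> by (meson dvd_trans int_dvd_int_iff)
    ultimately have "int p dvd t * int j - (t * int j - e)" by (meson dvd_diff dvd_mult)
    then show False using D(4) by simp
  qed
  then have npj: "\<not> p dvd j" by simp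
  then have "coprime j p" using p(1) by (metis coprime_commute prime_imp_coprime)
  moreover have "j > 0" using npj by (cases j) auto
  ultimately have "tiles (p ^ a * m) (int (j * m) * 1) S D"
    using p by (intro tiles_mult_coprime[OF T pos]) auto
  moreover have "[int (j * m) * 1 * s + d' = int (j * m) * 1 * s' + d] (mod int (p ^ a * m))"
  proof -
    obtain w where w: "t * int j - e = int r * w" using tj by auto
    have pa: "int p ^ v * int r = int p ^ a" unfolding r_def using v by (simp flip: power_add)
    have "(int (j * m) * 1 * s + d') - (int (j * m) * 1 * s' + d) = int j * int m * (s - s') - (d - d')"
      by (simp add: algebra_simps)
    also have "\<dots> = int m * int p ^ v * (t * int j - e)"
      unfolding S(3) D(3) by (simp add: algebra_simps)
    also have "\<dots> = int m * (int p ^ v * int r) * w" unfolding w by simp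
    also have "\<dots> = int (p ^ a * m) * w" unfolding pa by simp
    finally show ?thesis by (simp add: cong_iff_dvd_diff)
  qed
  ultimately have "s = s'" using tiles_inj S D by blast
  then show False using S(3,4) p(1) by (auto simp: prime_gt_0_nat)
qed

text \<open>The quotient is the block of digits above \<open>b\<close>; once the digits below
  \<open>b\<close> agree, it determines the residue modulo \<open>b * c\<close>.\<close>

lemma mod_eq_imp_dvd_diff_mult:
  fixes x y b c :: int
  assumes "b dvd x - y" "(x mod (b * c)) div b = (y mod (b * c)) div b"
  shows "b * c dvd x - y"
proof -
  have "x mod (b * c) mod b = y mod (b * c) mod b"
    using assms(1) by (simp add: mod_mod_cancel mod_eq_dvd_iff)
  then have "x mod (b * c) = y mod (b * c)" using assms(2) by (metis div_mult_mod_eq)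
  then show ?thesis by (simp add: mod_eq_dvd_iff)
qed

lemma mod_div_less:
  fixes x b c :: int
  assumes "b > 0" "c > 0"
  shows "(x mod (b * c)) div b \<in> {0..<c}"
proof -
  have "x mod (b * c) < b * c" "0 \<le> x mod (b * c)" using assms by simp_all
  moreover have "b * (x mod (b * c) div b) \<le> x mod (b * c)"
    using assms(1) by (metis mult.commute div_mult_mod_eq le_add_same_cancel1 pos_mod_sign)
  ultimately have "b * (x mod (b * c) div b) < b * c" by simp
  then show ?thesis using assms \<open>0 \<le> x mod (b * c)\<close>
    by (auto simp: pos_imp_zdiv_nonneg_iff)
qed

text \<open>A second residue class in \<open>S\<close> would yield the valuation \<open>0\<close>
  besides the valuation \<open>v > 0\<close> of \<open>s - s'\<close>. Avoiding both leaves
  \<open>D\<close> at most \<open>m * p ^ (a - 2)\<close> elements, whereas the tiling demands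
  \<open>m * p ^ (a - 1)\<close>.\<close>

lemma tiles_prime_residues:
  assumes T: "tiles n 1 S D" and n: "n > 0" and p: "prime p" "card S = p"
    and s: "s \<in> S" "s' \<in> S" "s \<noteq> s'" "[s = s'] (mod int p)"
    and x: "x \<in> S" "y \<in> S"
  shows "[x = y] (mod int p)"
proof (rule ccontr)
  assume xy: "\<not> [x = y] (mod int p)"
  have p1: "p > 1" and pp: "prime (int p)" using p prime_gt_1_nat by auto
  have val: "\<exists>v t. z = int p ^ v * t \<and> \<not> int p dvd t" if "z \<noteq> 0" for z :: int
    using multiplicity_decompose'[of z "int p"] that pp by (metis mult.commute not_prime_unit)
  obtain a m where nm: "n = p ^ a * m" "\<not> p dvd m"
    using multiplicity_decompose'[of n p] n p(1) by (metis not_gr_zero not_prime_unit)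
  have m: "m > 0" using n nm by (cases m) auto
  have cop: "coprime m p" using nm(2) p(1) by (metis coprime_commute prime_imp_coprime)
  obtain v t where v: "s - s' = int p ^ v * t" "\<not> int p dvd t" using val[of "s - s'"] s by auto
  have v0: "v > 0"
    using v s(4) by (cases v) (auto simp: cong_iff_dvd_diff)
  \<comment> \<open>Distinctness modulo \<open>n\<close> does not give this, as \<open>s\<close> and
    \<open>s'\<close> might differ only modulo \<open>m\<close>. But then the multiplier
    \<open>m\<close>, which is coprime to \<open>p\<close>, would identify them.\<close>
  have va: "v < a"
  proof (rule ccontr)
    assume "\<not> v < a"
    then have "int p ^ a dvd s - s'" unfolding v by (simp add: le_imp_power_dvd)
    then have "int n dvd int m * (s - s')" unfolding nm by (simp add: mult.commute mult_dvd_mono)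
    then have "[int m * 1 * s + d = int m * 1 * s' + d] (mod int n)" for d
      by (simp add: cong_iff_dvd_diff algebra_simps)
    moreover have "tiles n (int m * 1) S D" using T n cop m p by (intro tiles_mult_coprime) auto
    moreover have "D \<noteq> {}" using tiles_card[OF T] n by auto
    ultimately show False using tiles_inj(1) s by blast
  qed
  have T': "tiles (p ^ a * m) 1 S D" using T nm by simp
  \<comment> \<open>The valuation \<open>0\<close> is realized in \<open>S\<close> by
    \<open>x\<close> and \<open>y\<close>, the valuation \<open>v\<close> by \<open>s\<close> and
    \<open>s'\<close>.\<close>
  have no_val: False
    if "d \<in> D" "d' \<in> D" "d - d' = int m * (int p ^ u * e)" "\<not> int p dvd e" "u = 0 \<or> u = v" for d d' u e
  proof (cases "u = 0")
    case True
    have "x - y = int p ^ 0 * (x - y)" "\<not> int p dvd x - y" using xy by (auto simp: cong_iff_dvd_diff)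
    then show False
      using tiles_translate_difference_valuation[OF T' p cop m x _ _ that(1,2) _ that(4), of 0] True that(3) va
      by simp
  next
    case False
    then show False
      using tiles_translate_difference_valuation[OF T' p cop m s(1,2) v that(1,2) _ that(4)] that va
      by simp
  qed
  \<comment> \<open>\<open>b\<close> counts the digit positions \<open>v + 1\<close> to
    \<open>a - 1\<close>.\<close>
  define b where "b = a - v - 1"
  have a_eq: "a = v + 1 + b" unfolding b_def using va by simp
  \<comment> \<open>\<open>h\<close> forgets exactly the \<open>p\<close>-adic digits number \<open>0\<close> and \<open>v\<close>.\<close>
  define h where "h = (\<lambda>d :: int. (d mod int m, (d mod (int p * int p ^ (v - 1))) div int p,
                     (d mod (int p ^ (v + 1) * int p ^ b)) div int p ^ (v + 1)))"
  have "inj_on h D"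
  proof (rule inj_onI, rule ccontr)
    fix d d' assume d: "d \<in> D" "d' \<in> D" "h d = h d'" "d \<noteq> d'"
    have "int m dvd d - d'" using d(3) by (simp add: h_def mod_eq_dvd_iff)
    then obtain w where w: "d - d' = int m * w" by auto
    moreover have "w \<noteq> 0" using w d(4) by auto
    ultimately obtain u e where ue: "d - d' = int m * (int p ^ u * e)" "\<not> int p dvd e"
      using val by metis
    \<comment> \<open>As \<open>m\<close> is coprime to \<open>p\<close>, the exponent
      \<open>u\<close> is the valuation of \<open>d - d'\<close> itself.\<close>
    have dvd_iff: "int p ^ i dvd d - d' \<longleftrightarrow> i \<le> u" for i
    proof -
      have "coprime (int p ^ i) (int m)" using cop by (simp add: coprime_commute)
      then have "int p ^ i dvd d - d' \<longleftrightarrow> int p ^ i dvd int p ^ u * e"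
        unfolding ue(1) by (rule coprime_dvd_mult_right_iff)
      also have "\<dots> \<longleftrightarrow> i \<le> u"
      proof
        assume div: "int p ^ i dvd int p ^ u * e"
        show "i \<le> u"
        proof (rule ccontr)
          assume "\<not> i \<le> u"
          then have "int p ^ u * int p dvd int p ^ i"
            using le_imp_power_dvd[of "Suc u" i "int p"] by (simp add: mult.commute)
          then have "int p ^ u * int p dvd int p ^ u * e" using div by (rule dvd_trans)
          then show False using ue(2) p1 by simp
        qed
      qed (simp add: le_imp_power_dvd)
      finally show ?thesis .
    qed
    have "\<not> (u = 0 \<or> u = v)" using no_val[OF d(1,2) ue] by blast
    then have u: "u \<noteq> 0" "u \<noteq> v" by auto
    \<comment> \<open>The divisibility climbs from \<open>1\<close> to \<open>p ^ a\<close>: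
      \<open>u \<noteq> 0\<close> and \<open>u \<noteq> v\<close> settle the two digits that
      \<open>h\<close> forgets, and \<open>h\<close> settles the others.\<close>
    have "int p dvd d - d'" using dvd_iff[of 1] u by simp
    then have "int p * int p ^ (v - 1) dvd d - d'"
      using d(3) by (intro mod_eq_imp_dvd_diff_mult) (auto simp: h_def)
    then have "int p ^ v dvd d - d'" using v0 by (simp flip: power_Suc)
    then have "v + 1 \<le> u" using dvd_iff u by simp
    then have "int p ^ (v + 1) dvd d - d'" using dvd_iff by blast
    then have "int p ^ (v + 1) * int p ^ b dvd d - d'"
      using d(3) by (intro mod_eq_imp_dvd_diff_mult) (auto simp: h_def)
    then have "int p ^ a dvd d - d'" unfolding a_eq by (simp add: power_add mult.assoc)
    moreover have "coprime (int p ^ a) (int m)" using cop by (simp add: coprime_commute)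
    ultimately have "int n dvd d - d'"
      unfolding nm using \<open>int m dvd d - d'\<close> by (simp add: divides_mult)
    then have "[1 * x + d = 1 * x + d'] (mod int n)" by (simp add: cong_iff_dvd_diff)
    then show False using tiles_inj(2)[OF T x(1) x(1) d(1,2)] d(4) by simp
  qed
  moreover have "h ` D \<subseteq> {0..<int m} \<times> {0..<int p ^ (v - 1)} \<times> {0..<int p ^ b}"
  proof (rule image_subsetI)
    fix d
    show "h d \<in> {0..<int m} \<times> {0..<int p ^ (v - 1)} \<times> {0..<int p ^ b}"
      using mod_div_less[of "int p" "int p ^ (v - 1)" d] mod_div_less[of "int p ^ (v + 1)" "int p ^ b" d] p1 m
      unfolding h_def by auto
  qed
  ultimately have "card D \<le> card ({0..<int m} \<times> {0..<int p ^ (v - 1)} \<times> {0..<int p ^ b})"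
    by (rule card_inj_on_le) auto
  also have "\<dots> = m * (p ^ (v - 1) * p ^ b)"
    by (simp add: card_cartesian_product nat_power_eq)
  \<comment> \<open>The left side equals \<open>n\<close>, while the bound is smaller by a factor
    \<open>p\<close>, since \<open>v + b = a - 1\<close>.\<close>
  finally have "p * card D \<le> p * (m * (p ^ (v - 1) * p ^ b))" by simp
  also have "\<dots> = m * p ^ (v + b)" using v0 by (cases v) (simp_all add: power_add)
  also have "\<dots> < m * p ^ a" using m p1 a_eq by simp
  finally show False using tiles_card[OF T] p nm by (simp add: mult.commute)
qed

section \<open>Degree and connectedness of Cayley sum graphs of cyclic groups\<close>

lemma cayley_sum_graph_integer_mod_group:
  assumes "n > 0"
  shows "pverts (cayley_sum_graph (integer_mod_group n) S) = {0..<int n}"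
    and "parcs (cayley_sum_graph (integer_mod_group n) S) =
      {(g, h). g \<in> {0..<int n} \<and> h \<in> {0..<int n} \<and> (g + h) mod int n \<in> S \<and> g \<noteq> h}"
  using assms by (auto simp: cayley_sum_graph_def carrier_integer_mod_group)

text \<open>Arcs from \<open>g\<close> inject into \<open>S\<close> by the sum of their endpoints.
  As loops are excluded, the value \<open>g + g\<close> is never taken, so it cannot lie in
  \<open>S\<close> when the degree is \<open>card S\<close>.\<close>

lemma out_degree_cayley_sum_graph_imp_double_notin:
  assumes n: "n > 0" and S: "finite S" and g: "g \<in> {0..<int n}"
    and deg: "out_degree (with_proj (cayley_sum_graph (integer_mod_group n) S)) g = card S"
  shows "(g + g) mod int n \<notin> S"
proof
  assume gg: "(g + g) mod int n \<in> S"
  let ?A = "out_arcs (with_proj (cayley_sum_graph (integer_mod_group n) S)) g"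
  have "inj_on (\<lambda>e. (g + snd e) mod int n) ?A"
  proof (rule inj_onI)
    fix e e' assume e: "e \<in> ?A" "e' \<in> ?A" "(g + snd e) mod int n = (g + snd e') mod int n"
    then have "[g + snd e = g + snd e'] (mod int n)" by (simp add: cong_def)
    then have "[snd e = snd e'] (mod int n)" by (simp add: cong_add_lcancel)
    then show "e = e'"
      using e n by (auto simp: cayley_sum_graph_integer_mod_group out_arcs_def cong_def)
  qed
  moreover have "(\<lambda>e. (g + snd e) mod int n) ` ?A \<subseteq> S - {(g + g) mod int n}"
  proof (rule image_subsetI)
    fix e assume e: "e \<in> ?A"
    then obtain h where h: "e = (g, h)" "h \<in> {0..<int n}" "(g + h) mod int n \<in> S" "g \<noteq> h"
      using n by (auto simp: cayley_sum_graph_integer_mod_group out_arcs_def)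
    have "(g + h) mod int n \<noteq> (g + g) mod int n"
    proof
      assume "(g + h) mod int n = (g + g) mod int n"
      then have "[h = g] (mod int n)" by (metis cong_add_lcancel cong_def)
      then show False using h g by (simp add: cong_def)
    qed
    then show "(g + snd e) mod int n \<in> S - {(g + g) mod int n}" using h by simp
  qed
  ultimately have "card ?A \<le> card (S - {(g + g) mod int n})"
    using S by (intro card_inj_on_le) auto
  also have "\<dots> < card S" using S gg by (rule card_Diff1_less)
  finally show False using deg by (simp add: out_degree_def)
qed

text \<open>If all of \<open>S\<close> were congruent to \<open>c\<close>, every arc would lead from
  a residue \<open>r\<close> modulo \<open>p\<close> to \<open>c - r\<close>. The classes of
  \<open>0\<close> and \<open>c\<close> would then be closed under adjacency, and
  \<open>p \<ge> 3\<close> leaves a further class.\<close>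

lemma connected_cayley_sum_graph_imp_not_all_cong:
  assumes n: "n > 0" and p: "p dvd n" "p \<ge> 3"
    and conn: "Digraph_Component.connected (with_proj (cayley_sum_graph (integer_mod_group n) S))"
  shows "\<exists>s\<in>S. \<not> [s = c] (mod int p)"
proof (rule ccontr)
  let ?G = "mk_symmetric (with_proj (cayley_sum_graph (integer_mod_group n) S))"
  assume "\<not> ?thesis"
  then have S: "[s = c] (mod int p)" if "s \<in> S" for s using that by blast
  \<comment> \<open>A vertex among \<open>1\<close> and \<open>2\<close> whose residue avoids both
    \<open>0\<close> and \<open>c\<close>.\<close>
  define g where "g = (if [1 = c] (mod int p) then 2 else 1 :: int)"
  have g: "\<not> [g = c] (mod int p)" "\<not> [g = 0] (mod int p)"
  proof -
    show "\<not> [g = 0] (mod int p)" using p by (auto simp: g_def cong_def)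
    show "\<not> [g = c] (mod int p)"
    proof (cases "[1 = c] (mod int p)")
      case True
      have "\<not> [2 = 1 :: int] (mod int p)" using p by (auto simp: cong_def)
      then have "\<not> [2 = c] (mod int p)" using cong_trans[OF _ cong_sym[OF True]] by blast
      then show ?thesis using True by (simp add: g_def)
    qed (simp add: g_def)
  qed
  have "n \<ge> 3" using dvd_imp_le[OF p(1) n] p(2) by simp
  then have vg: "g \<in> {0..<int n}" "0 \<in> {0..<int n}" by (auto simp: g_def)
  then have "(0, g) \<in> rtrancl_on {0..<int n} (parcs ?G)"
    using conn n unfolding connected_def strongly_connected_def reachable_def
    by (simp add: cayley_sum_graph_integer_mod_group)
  then have "(0, g) \<in> (parcs ?G)\<^sup>*" by (rule rtrancl_on_rtranclI)
  then have "[g = 0] (mod int p) \<or> [g = c] (mod int p)"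
  proof (induction rule: rtrancl_induct)
    case (step x y)
    then have "(x + y) mod int n \<in> S"
      using n by (auto simp: parcs_mk_symmetric cayley_sum_graph_integer_mod_group add.commute)
    then have "[(x + y) mod int n = c] (mod int p)" by (rule S)
    moreover have "[(x + y) mod int n = x + y] (mod int p)"
      using p(1) by (simp add: cong_def mod_mod_cancel)
    ultimately have xy: "[x + y = c] (mod int p)" by (metis cong_trans cong_sym)
    from step.IH show ?case
    proof (elim disjE)
      assume "[x = 0] (mod int p)"
      then have "[x + y = 0 + y] (mod int p)" by (rule cong_add) simp
      then show ?thesis using xy by (metis add_0 cong_trans cong_sym)
    next
      assume "[x = c] (mod int p)"
      then have "[x + y = c + y] (mod int p)" by (rule cong_add) simp
      then have "[c + y = c + 0] (mod int p)" using xy by (metis add_0_right cong_trans cong_sym)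
      then show ?thesis unfolding cong_add_lcancel ..
    qed
  qed simp
  then show False using g by blast
qed

section \<open>Total perfect codes and tilings\<close>

lemma total_perfect_code_cayley_sum_graph_iff:
  assumes n: "n > 0" and dbl: "\<And>g. g \<in> {0..<int n} \<Longrightarrow> (g + g) mod int n \<notin> S"
  shows "total_perfect_code (with_proj (cayley_sum_graph (integer_mod_group n) S)) C \<longleftrightarrow>
    C \<subseteq> {0..<int n} \<and> (\<forall>g\<in>{0..<int n}. \<exists>!c. c \<in> C \<and> (g + c) mod int n \<in> S)"
proof -
  let ?G = "with_proj (cayley_sum_graph (integer_mod_group n) S)"
  have "(c \<in> C \<and> g \<rightarrow>\<^bsub>?G\<^esub> c) \<longleftrightarrow> (c \<in> C \<and> (g + c) mod int n \<in> S)"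
    if "C \<subseteq> {0..<int n}" "g \<in> {0..<int n}" for c g
    using that n dbl[of g] by (auto simp: cayley_sum_graph_integer_mod_group)
  then show ?thesis
    using n unfolding total_perfect_code_def with_proj_simps cayley_sum_graph_integer_mod_group(1)[OF n]
    by (intro conj_cong ball_cong) auto
qed

text \<open>\<open>g + c = s\<close> means \<open>g = s + (- c)\<close>: existence of a neighbor in
  \<open>C\<close> gives surjectivity, uniqueness gives injectivity.\<close>

lemma perfect_code_imp_tiles:
  assumes n: "n > 0" and S: "S \<subseteq> {0..<int n}" and C: "C \<subseteq> {0..<int n}"
    and code: "\<And>g. g \<in> {0..<int n} \<Longrightarrow> \<exists>!c. c \<in> C \<and> (g + c) mod int n \<in> S"
  shows "tiles n 1 S (uminus ` C)"
  unfolding tiles_def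
proof (rule bij_betwI')
  fix z w assume z: "z \<in> S \<times> uminus ` C" and w: "w \<in> S \<times> uminus ` C"
  obtain s c t e where zw: "z = (s, - c)" "w = (t, - e)" "s \<in> S" "t \<in> S" "c \<in> C" "e \<in> C"
    using z w by auto
  have st: "s mod int n = s" "t mod int n = t" using zw S by auto
  show "((case z of (s, d) \<Rightarrow> (1 * s + d) mod int n) = (case w of (s, d) \<Rightarrow> (1 * s + d) mod int n)) = (z = w)"
  proof
    assume "(case z of (s, d) \<Rightarrow> (1 * s + d) mod int n) = (case w of (s, d) \<Rightarrow> (1 * s + d) mod int n)"
    then have eq: "(s - c) mod int n = (t - e) mod int n" using zw by simp
    \<comment> \<open>Both \<open>c\<close> and \<open>e\<close> complete the vertex
      \<open>(s - c) mod int n\<close> to an element of \<open>S\<close>.\<close>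
    have "((s - c) mod int n + c) mod int n = s" using st by (simp add: mod_add_left_eq)
    moreover have "((s - c) mod int n + e) mod int n = t" unfolding eq using st by (simp add: mod_add_left_eq)
    moreover have "(s - c) mod int n \<in> {0..<int n}" using n by simp
    ultimately have "c = e" using code zw by metis
    moreover from this have "s = t" using \<open>((s - c) mod int n + c) mod int n = s\<close>
        \<open>((s - c) mod int n + e) mod int n = t\<close> by simp
    ultimately show "z = w" using zw by simp
  qed simp
next
  fix z assume "z \<in> S \<times> uminus ` C"
  then show "(case z of (s, d) \<Rightarrow> (1 * s + d) mod int n) \<in> {0..<int n}" using n by auto
next
  fix g assume g: "g \<in> {0..<int n}"
  then obtain c where c: "c \<in> C" "(g + c) mod int n \<in> S" using code by blast
  have "(1 * ((g + c) mod int n) + - c) mod int n = (g + c - c) mod int n"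
    by (simp add: mod_diff_left_eq)
  then have "g = (1 * ((g + c) mod int n) + - c) mod int n" using g by simp
  then show "\<exists>z\<in>S \<times> uminus ` C. g = (case z of (s, d) \<Rightarrow> (1 * s + d) mod int n)"
    using c by (intro bexI[of _ "((g + c) mod int n, - c)"]) auto
qed

text \<open>\<open>S\<close> is a complete residue system modulo \<open>p\<close>, so exactly one
  \<open>s\<close> in \<open>S\<close> is congruent to \<open>g\<close>, and \<open>c\<close> must
  be \<open>s - g\<close> modulo \<open>n\<close>.\<close>

lemma multiples_perfect_code:
  assumes n: "n > 0" and p: "p dvd n" and S: "card S = p" "S \<subseteq> {0..<int n}"
    and dist: "\<And>s s'. s \<in> S \<Longrightarrow> s' \<in> S \<Longrightarrow> [s = s'] (mod int p) \<Longrightarrow> s = s'"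
  shows "\<exists>!c. c \<in> {c \<in> {0..<int n}. int p dvd c} \<and> (g + c) mod int n \<in> S"
proof -
  have p0: "p > 0" using n p by (cases p) auto
  have cong_p: "[x mod int n = x] (mod int p)" for x :: int
    using p by (simp add: cong_def mod_mod_cancel)
  have "inj_on (\<lambda>s. s mod int p) S" using dist by (auto intro!: inj_onI simp: cong_def)
  then have "card ((\<lambda>s. s mod int p) ` S) = card {0..<int p}" using S by (simp add: card_image)
  moreover have "(\<lambda>s. s mod int p) ` S \<subseteq> {0..<int p}" using p0 by auto
  ultimately have "(\<lambda>s. s mod int p) ` S = {0..<int p}" by (intro card_subset_eq) auto
  moreover have "g mod int p \<in> {0..<int p}" using p0 by simp
  ultimately obtain s where s: "s \<in> S" "[s = g] (mod int p)"
    unfolding cong_def by (metis (no_types, lifting) imageE)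
  show ?thesis
  proof (rule ex1I[of _ "(s - g) mod int n"])
    have "(g + (s - g) mod int n) mod int n = s" using s S(2) by (auto simp: mod_add_right_eq)
    moreover have "int p dvd (s - g) mod int n"
      using s(2) p by (simp add: dvd_mod_iff cong_iff_dvd_diff)
    ultimately show "(s - g) mod int n \<in> {c \<in> {0..<int n}. int p dvd c} \<and>
        (g + (s - g) mod int n) mod int n \<in> S"
      using s n by simp
  next
    fix c assume c: "c \<in> {c \<in> {0..<int n}. int p dvd c} \<and> (g + c) mod int n \<in> S"
    have "[(g + c) mod int n = g + c] (mod int p)" by (rule cong_p)
    moreover have "[g + c = g] (mod int p)" using c by (simp add: cong_iff_dvd_diff)
    ultimately have "(g + c) mod int n = s" using c s dist by (metis cong_sym cong_trans)
    then have "(s - g) mod int n = (g + c - g) mod int n" by (metis mod_diff_left_eq)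
    then show "c = (s - g) mod int n" using c by simp
  qed
qed

theorem theorem3p6:
  fixes n p :: nat and S :: "int set"
  assumes "n > 0" and "prime p" and "odd p" and "p dvd n"
    and "S \<subseteq> carrier (integer_mod_group n)" and "card S = p"
    and "Digraph_Component.connected (with_proj (cayley_sum_graph (integer_mod_group n) S))"
    and "\<forall>g \<in> verts (with_proj (cayley_sum_graph (integer_mod_group n) S)).
           out_degree (with_proj (cayley_sum_graph (integer_mod_group n) S)) g = p"
  shows "(\<exists>C. total_perfect_code (with_proj (cayley_sum_graph (integer_mod_group n) S)) C) \<longleftrightarrow>
         (\<forall>s \<in> S. \<forall>s' \<in> S. s \<noteq> s' \<longrightarrow> \<not> [s = s'] (mod int p))"
proof -
  have S: "S \<subseteq> {0..<int n}" using assms(1,5) by (simp add: carrier_integer_mod_group)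
  have p3: "p \<ge> 3" using assms(2,3) prime_ge_2_nat[of p] by (cases "p = 2") auto
  have dbl: "(g + g) mod int n \<notin> S" if "g \<in> {0..<int n}" for g
    using out_degree_cayley_sum_graph_imp_double_notin[OF assms(1) _ that, of S] assms(6,8) S that
    by (simp add: finite_subset cayley_sum_graph_integer_mod_group assms(1))
  have code_iff: "total_perfect_code (with_proj (cayley_sum_graph (integer_mod_group n) S)) C \<longleftrightarrow>
      C \<subseteq> {0..<int n} \<and> (\<forall>g\<in>{0..<int n}. \<exists>!c. c \<in> C \<and> (g + c) mod int n \<in> S)" for C
    using assms(1) dbl by (rule total_perfect_code_cayley_sum_graph_iff)
  show ?thesis
  proof
    assume "\<exists>C. total_perfect_code (with_proj (cayley_sum_graph (integer_mod_group n) S)) C"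
    then obtain C where C: "C \<subseteq> {0..<int n}"
        "\<forall>g\<in>{0..<int n}. \<exists>!c. c \<in> C \<and> (g + c) mod int n \<in> S"
      unfolding code_iff by (elim exE conjE)
    then have T: "tiles n 1 S (uminus ` C)"
      by (intro perfect_code_imp_tiles[OF assms(1) S C(1)]) (rule bspec)
    show "\<forall>s \<in> S. \<forall>s' \<in> S. s \<noteq> s' \<longrightarrow> \<not> [s = s'] (mod int p)"
    proof (intro ballI impI notI)
      fix s s' assume s: "s \<in> S" "s' \<in> S" "s \<noteq> s'" "[s = s'] (mod int p)"
      obtain x where "x \<in> S" "\<not> [x = s] (mod int p)"
        using connected_cayley_sum_graph_imp_not_all_cong[OF assms(1,4) p3 assms(7)] by blast
      then show False using tiles_prime_residues[OF T assms(1,2,6) s] s(1) by blast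
    qed
  next
    assume "\<forall>s \<in> S. \<forall>s' \<in> S. s \<noteq> s' \<longrightarrow> \<not> [s = s'] (mod int p)"
    then have "\<exists>!c. c \<in> {c \<in> {0..<int n}. int p dvd c} \<and> (g + c) mod int n \<in> S" for g
      by (intro multiples_perfect_code[OF assms(1,4,6) S]) blast
    then have "total_perfect_code (with_proj (cayley_sum_graph (integer_mod_group n) S))
        {c \<in> {0..<int n}. int p dvd c}"
      unfolding code_iff by auto
    then show "\<exists>C. total_perfect_code (with_proj (cayley_sum_graph (integer_mod_group n) S)) C" ..
  qed
qed

end
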